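(* For every integer $k\geq 3$ there exists a connected $k$-regular graph $G$ of diameter $4$ such that $t(G)<1$ and the second largest eigenvalue $\lambda_2(G)$ of its adjacency matrix satisfies $$\lambda_2(G)=\begin{cases}\frac{k-2+\sqrt{k^2+8}}{2} & \text{when } k \text{ is odd},\\ \frac{k-2+\sqrt{k^2+12}}{2} & \text{when } k \text{ is even}.\end{cases}$$
   Context: All graphs are finite, simple and undirected. Adjacency eigenvalues are listed with multiplicity as $\lambda_1\ge\lambda_2\ge\dots\ge\lambda_n$. For a connected graph $G$ and a vertex subset $S$, $c(G\setminus S)$ denotes the number of connected components of the graph obtained from $G$ by removing the vertices of $S$. The toughness of $G$ is $t(G)=\min_S \frac{|S|}{c(G\setminus S)}$, the minimum being over all vertex subsets $S$ whose removal disconnects $G$ (i.e. $c(G\setminus S)\ge 2$). *)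

theory Defs
  imports
    "Graph_Theory.Digraph_Component"
    "Graph_Theory.Shortest_Path"
    "Jordan_Normal_Form.Char_Poly"
begin

definition regular_graph :: "nat \<Rightarrow> ('a, 'b) pre_digraph \<Rightarrow> bool" where
  "regular_graph k G \<longleftrightarrow> (\<forall>v\<in>verts G. out_degree G v = k)"

text \<open>The library has weighted shortest paths only; constant weight 1 gives the number of
  edges of a shortest walk.\<close>

definition graph_dist :: "('a, 'b) pre_digraph \<Rightarrow> 'a \<Rightarrow> 'a \<Rightarrow> ereal" where
  "graph_dist G u v = wf_digraph.\<mu> G (\<lambda>_. 1) u v"

definition graph_diameter :: "('a, 'b) pre_digraph \<Rightarrow> ereal" where
  "graph_diameter G = (SUP u\<in>verts G. SUP v\<in>verts G. graph_dist G u v)"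

definition remove_verts :: "('a, 'b) pre_digraph \<Rightarrow> 'a set \<Rightarrow> ('a, 'b) pre_digraph" where
  "remove_verts G S = G \<restriction> (verts G - S)"

text \<open>On a symmetric digraph the strongly connected components are the connected components of
  the undirected graph.\<close>

definition num_components :: "('a, 'b) pre_digraph \<Rightarrow> nat" where
  "num_components G = card (pre_digraph.sccs G)"

text \<open>A complete graph has no disconnecting vertex set; its toughness is left unspecified
  here, as the value of \<^const>\<open>Min\<close> on the empty set.\<close>

definition toughness :: "('a, 'b) pre_digraph \<Rightarrow> real" where
  "toughness G =
     Min {real (card S) / real (num_components (remove_verts G S)) | S.
            S \<subseteq> verts G \<and> num_components (remove_verts G S) \<ge> 2}"

text \<open>Rows and columns follow the increasing enumeration of the vertices; the spectrum does not
  depend on this choice.\<close>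

definition adjacency_matrix :: "('a::linorder, 'b) pre_digraph \<Rightarrow> real mat" where
  "adjacency_matrix G =
     (let vs = sorted_list_of_set (verts G); n = card (verts G)
      in mat n n (\<lambda>(i, j). if vs ! i \<rightarrow>\<^bsub>G\<^esub> vs ! j then 1 else 0))"

text \<open>For an undirected graph this matrix is real symmetric, so its characteristic polynomial
  splits over the reals and the list below has exactly as many entries as there are vertices.\<close>

definition adjacency_eigenvalues :: "('a::linorder, 'b) pre_digraph \<Rightarrow> real list" where
  "adjacency_eigenvalues G =
     rev (sorted_list_of_multiset (proots (char_poly (adjacency_matrix G))))"

text \<open>The eigenvalues are numbered from 1, in non-increasing order.\<close>

definition nth_eigenvalue :: "('a::linorder, 'b) pre_digraph \<Rightarrow> nat \<Rightarrow> real" where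
  "nth_eigenvalue G i = adjacency_eigenvalues G ! (i - 1)"

end

theory Submission
  imports Defs
begin

text \<open>Let \<open>p = 2\<close> for odd \<open>k\<close>, \<open>p = 3\<close> for even \<open>k\<close>, and \<open>m = k + 1 - p\<close>, which is even. The graph
  consists of \<open>k\<close> blocks, each a copy of \<open>K\<^bsub>k+1\<^esub>\<close> minus a perfect matching on \<open>m\<close> of its vertices, and
  of \<open>m\<close> further cut vertices, the \<open>i\<close>-th of which is joined to the \<open>i\<close>-th matched vertex of every
  block. Deleting the cut vertices leaves \<open>k > m\<close> components.

  The larger eigenvalue \<open>\<theta>\<close> of the quotient of a block is an eigenvalue of the graph, by placing its
  eigenvector on one block and its negative on another. Conversely, above \<open>\<theta>\<close> the eigenvalue
  equations force an eigenvector to be constant on matched pairs, then on each part of a block, then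
  across the blocks; what remains is a 3-by-3 system whose only root above \<open>\<theta>\<close> is \<open>k\<close>, with constant
  eigenvectors. As \<open>k\<close> is a simple root of the characteristic polynomial, the second largest
  eigenvalue is \<open>\<theta>\<close>.\<close>

section \<open>Linear algebra: sorted root lists and simplicity of the row-sum eigenvalue\<close>

lemma sorted_list_of_multiset_eqI:
  assumes "sorted xs" "mset xs = M"
  shows "sorted_list_of_multiset M = xs"
  using assms by (metis sorted_list_of_multiset_mset sort_key_id_if_sorted map_ident)

text \<open>As \<open>a\<close> is a simple root, removing one \<open>a\<close> and one
  \<open>b\<close> from the root multiset leaves only roots at most \<open>b\<close>. Hence the
  ascending list ends in \<open>[b, a]\<close>, and index 1 of its reversal, the second largest
  entry, is \<open>b\<close>, whatever the multiplicity of \<open>b\<close>.\<close>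

lemma second_largest_root:
  fixes q :: "real poly"
  assumes q0: "q \<noteq> 0" and ord: "order a q = 1" and b: "poly q b = 0" and ba: "b < a"
    and max: "\<And>x. poly q x = 0 \<Longrightarrow> x = a \<or> x \<le> b"
  shows "rev (sorted_list_of_multiset (proots q)) ! 1 = b"
proof -
  define R where "R = proots q - {#a#} - {#b#}"
  have in_roots: "x \<in># proots q \<longleftrightarrow> poly q x = 0" for x
    using q0 by simp
  have cnt: "count (proots q) a = 1"
    using q0 ord by simp
  then have "a \<in># proots q"
    by (metis count_eq_zero_iff zero_neq_one)
  moreover have "b \<in># proots q"
    using b in_roots by blast
  ultimately have dec: "proots q = add_mset a (add_mset b R)"
    unfolding R_def using ba by (metis insert_DiffM insert_noteq_member less_irrefl)
  have le: "x \<le> b" if "x \<in># R" for x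
  proof -
    have "a \<notin># R"
      using cnt ba unfolding dec by (simp add: count_eq_zero_iff)
    then have "x \<noteq> a"
      using that by blast
    moreover have "poly q x = 0"
      using that in_roots unfolding dec by auto
    ultimately show ?thesis
      using max by blast
  qed
  have "sorted_list_of_multiset (proots q) = sorted_list_of_multiset R @ [b, a]"
  proof (rule sorted_list_of_multiset_eqI)
    show "sorted (sorted_list_of_multiset R @ [b, a])"
      using le ba by (fastforce simp: sorted_append)
    show "mset (sorted_list_of_multiset R @ [b, a]) = proots q"
      unfolding dec by simp
  qed
  then show ?thesis by simp
qed

text \<open>Subtracting the first row from the others and adding the other columns to the first is a
  similarity, and it splits off the eigenvector with all entries 1.\<close>

lemma char_poly_deflate_constant_row_sums:
  fixes a :: "nat \<Rightarrow> nat \<Rightarrow> real"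
  assumes rows: "\<And>i. i < Suc n \<Longrightarrow> (\<Sum>j<Suc n. a i j) = e"
  shows "char_poly (mat (Suc n) (Suc n) (\<lambda>(i, j). a i j)) =
    [:- e, 1:] * char_poly (mat n n (\<lambda>(i, j). a (Suc i) (Suc j) - a 0 (Suc j)))"
proof -
  let ?N = "Suc n"
  define A where "A = mat ?N ?N (\<lambda>(i, j). a i j)"
  define B where "B = mat n n (\<lambda>(i, j). a (Suc i) (Suc j) - a 0 (Suc j))"
  define E where "E = mat 1 1 (\<lambda>(i::nat, j::nat). e)"
  define R where "R = mat 1 n (\<lambda>(i::nat, j). a 0 (Suc j))"
  define D where "D = four_block_mat E R (0\<^sub>m n 1) B"
  define P :: "real mat" where "P = mat ?N ?N (\<lambda>(i, j). if i = j \<or> j = 0 then 1 else 0)"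
  define Q :: "real mat" where
    "Q = mat ?N ?N (\<lambda>(i, j). if i = j then 1 else if j = 0 then - 1 else 0)"
  have carr: "A \<in> carrier_mat ?N ?N" "P \<in> carrier_mat ?N ?N" "Q \<in> carrier_mat ?N ?N"
    "D \<in> carrier_mat ?N ?N" "B \<in> carrier_mat n n" "E \<in> carrier_mat 1 1" "R \<in> carrier_mat 1 n"
    by (auto simp: A_def P_def Q_def D_def B_def E_def R_def)
  have D_entry: "D $$ (i, j) = (if j = 0 then (if i = 0 then e else 0) else
      if i = 0 then a 0 j else a i j - a 0 j)" if "i < ?N" "j < ?N" for i j
    using that by (cases i; cases j) (auto simp: D_def E_def R_def B_def four_block_mat_def Let_def)
  have P_row: "(\<Sum>l<?N. P $$ (i, l) * f l) = (if i \<noteq> 0 then f i else 0) + f 0"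
    if "i < ?N" for i and f :: "nat \<Rightarrow> real"
  proof -
    have "(\<Sum>l<?N. P $$ (i, l) * f l) =
        (\<Sum>l<?N. (if l = i then (if i \<noteq> 0 then f i else 0) else 0) + (if l = 0 then f l else 0))"
      using that by (intro sum.cong) (auto simp: P_def)
    then show ?thesis using that by (simp add: sum.distrib)
  qed
  have PQ: "P * Q = 1\<^sub>m ?N"
  proof (rule eq_matI)
    fix i j assume "i < dim_row (1\<^sub>m ?N :: real mat)" "j < dim_col (1\<^sub>m ?N :: real mat)"
    then have i: "i < ?N" and j: "j < ?N" by auto
    have "(P * Q) $$ (i, j) = (\<Sum>l<?N. P $$ (i, l) * Q $$ (l, j))"
      using carr i j by (simp add: scalar_prod_def atLeast0LessThan)
    then show "(P * Q) $$ (i, j) = 1\<^sub>m ?N $$ (i, j)"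
      unfolding P_row[OF i] using i j by (auto simp: Q_def)
  qed (use carr in auto)
  have QP: "Q * P = 1\<^sub>m ?N"
    using mat_mult_left_right_inverse[OF carr(2,3) PQ] .
  have PD: "P * D = A * P"
  proof (rule eq_matI)
    fix i j assume "i < dim_row (A * P)" "j < dim_col (A * P)"
    then have i: "i < ?N" and j: "j < ?N" using carr by auto
    have "(P * D) $$ (i, j) = (\<Sum>l<?N. P $$ (i, l) * D $$ (l, j))"
      using carr i j by (simp add: scalar_prod_def atLeast0LessThan)
    also have "\<dots> = (if i \<noteq> 0 then D $$ (i, j) else 0) + D $$ (0, j)"
      by (rule P_row[OF i])
    also have "\<dots> = (if j = 0 then e else a i j)"
      using i j by (auto simp: D_entry)
    also have "\<dots> = (\<Sum>l<?N. a i l * (if l = j \<or> j = 0 then 1 else 0))"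
      using rows[OF i] j by (cases "j = 0") (simp_all add: if_distrib del: sum.lessThan_Suc cong: if_cong)
    also have "\<dots> = (A * P) $$ (i, j)"
      using i j carr by (simp add: scalar_prod_def atLeast0LessThan A_def P_def)
    finally show "(P * D) $$ (i, j) = (A * P) $$ (i, j)" .
  qed (use carr in auto)
  have "A = P * D * Q"
    unfolding PD using carr PQ by (simp add: assoc_mult_mat[of _ ?N ?N _ ?N _ ?N])
  then have "similar_mat A D"
    using carr PQ QP by (intro similar_matI[of _ _ P Q ?N]) auto
  then have "char_poly A = char_poly D"
    by (rule char_poly_similar)
  also have "\<dots> = char_poly E * char_poly B"
    unfolding D_def by (rule char_poly_four_block_zeros_col[OF carr(6,7,5)])
  also have "char_poly E = [:- e, 1:]"
    by (simp add: E_def char_poly_defs det_single)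
  finally show ?thesis
    unfolding A_def B_def .
qed

text \<open>A generalized eigenvector \<open>u\<close> of rank two would satisfy
  \<open>A u = e u + c 1\<close>; column sums force \<open>c = 0\<close>.\<close>

lemma order_char_poly_constant_row_sums:
  fixes a :: "nat \<Rightarrow> nat \<Rightarrow> real"
  assumes n: "0 < n"
    and rows: "\<And>i. i < n \<Longrightarrow> (\<Sum>j<n. a i j) = e"
    and cols: "\<And>j. j < n \<Longrightarrow> (\<Sum>i<n. a i j) = e"
    and const: "\<And>u i. (\<And>i. i < n \<Longrightarrow> (\<Sum>j<n. a i j * u j) = e * u i) \<Longrightarrow> i < n \<Longrightarrow> u i = u 0"
  shows "order e (char_poly (mat n n (\<lambda>(i, j). a i j))) = 1"
proof -
  obtain r where r: "n = Suc r" using n by (cases n) auto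
  define B where "B = mat r r (\<lambda>(i, j). a (Suc i) (Suc j) - a 0 (Suc j))"
  have B: "B \<in> carrier_mat r r" by (simp add: B_def)
  have "\<not> eigenvalue B e"
  proof
    assume "eigenvalue B e"
    then obtain w where w: "w \<in> carrier_vec r" "w \<noteq> 0\<^sub>v r" "B *\<^sub>v w = e \<cdot>\<^sub>v w"
      using B unfolding eigenvalue_def eigenvector_def by auto
    \<comment> \<open>Padding \<open>w\<close> with a leading 0 gives the generalized eigenvector.
      Each row of \<open>B\<close> is a row of the full matrix minus row 0, so \<open>c\<close>, the
      value of row 0 at \<open>u\<close>, is the same error term in every equation.\<close>
    define u where "u i = (case i of 0 \<Rightarrow> 0 | Suc i \<Rightarrow> w $ i)" for i
    define c where "c = (\<Sum>j<n. a 0 j * u j)"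
    have u0: "u 0 = 0" by (simp add: u_def)
    have split: "(\<Sum>j<n. f j * u j) = (\<Sum>j<r. f (Suc j) * w $ j)" for f
      unfolding r by (subst sum.lessThan_Suc_shift) (simp add: u_def)
    have Au: "(\<Sum>j<n. a i j * u j) = e * u i + c" if "i < n" for i
    proof (cases i)
      case 0 then show ?thesis by (simp add: c_def u0)
    next
      case (Suc l)
      then have l: "l < r" using that r by simp
      have "(B *\<^sub>v w) $ l = (\<Sum>j<r. (a (Suc l) (Suc j) - a 0 (Suc j)) * w $ j)"
        using l w(1) by (simp add: B_def scalar_prod_def atLeast0LessThan)
      then have "e * w $ l = (\<Sum>j<r. (a (Suc l) (Suc j) - a 0 (Suc j)) * w $ j)"
        using w(1,3) l by simp
      then show ?thesis
        unfolding c_def split Suc by (simp add: u_def sum_subtractf left_diff_distrib)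
    qed
    have "e * (\<Sum>j<n. u j) = (\<Sum>j<n. (\<Sum>i<n. a i j) * u j)"
      using cols by (simp add: sum_distrib_left)
    also have "\<dots> = (\<Sum>i<n. \<Sum>j<n. a i j * u j)"
      unfolding sum_distrib_right by (rule sum.swap)
    also have "\<dots> = e * (\<Sum>i<n. u i) + n * c"
      using Au by (simp add: sum.distrib sum_distrib_left)
    finally have "c = 0" using n by simp
    then have "u i = 0" if "i < n" for i
      using const[of u i] Au that u0 by simp
    then have "w $ i = 0" if "i < r" for i
      using that r by (metis Suc_mono u_def nat.case(2))
    then have "w = 0\<^sub>v r"
      using w(1) by (intro eq_vecI) auto
    then show False using w(2) by simp
  qed
  then have "poly (char_poly B) e \<noteq> 0"
    using eigenvalue_root_char_poly[OF B] by simp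
  then have "order e (char_poly B) = 0" "char_poly B \<noteq> 0"
    by (auto simp: order_0I)
  moreover have "char_poly (mat n n (\<lambda>(i, j). a i j)) = [:- e, 1:] * char_poly B"
    using char_poly_deflate_constant_row_sums[of r a e] rows unfolding r B_def by simp
  moreover have "order e [:- e, 1:] = 1"
    using order_power_n_n[of e 1] by simp
  moreover have "[:- e, 1:] * char_poly B \<noteq> 0"
    using \<open>char_poly B \<noteq> 0\<close> by (simp del: mult_pCons_left)
  ultimately show ?thesis
    by (simp add: order_mult del: mult_pCons_left)
qed

section \<open>Eigenvalue equations in block coordinates\<close>

text \<open>The removed matching as an involution on indices. It pairs \<open>2 * l\<close> with
  \<open>2 * l + 1\<close>, so an even bound \<open>m\<close> never splits a pair.\<close>

definition partner :: "nat \<Rightarrow> nat" where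
  "partner i = (if even i then i + 1 else i - 1)"

lemma partner_partner [simp]: "partner (partner i) = i"
  by (auto simp: partner_def)

lemma partner_neq [simp]: "partner i \<noteq> i"
  by (auto simp: partner_def elim: oddE)

lemma div_2_eq_iff_partner: "i div 2 = j div 2 \<longleftrightarrow> j = i \<or> j = partner i" for i j :: nat
  unfolding partner_def by (cases "even i") presburger+

lemma partner_less:
  assumes "even m" "i < m"
  shows "partner i < m"
  using assms unfolding partner_def by (cases "even i") presburger+

text \<open>Treats both parities of \<open>k\<close> at once: a block has \<open>m\<close> matched
  and \<open>p\<close> unmatched vertices. Evenness of \<open>m\<close> makes the matching perfect,
  and \<open>2 \<le> p\<close> gives \<open>m < k\<close>, fewer cut vertices than blocks.\<close>

locale tough_graph =
  fixes k p m :: nat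
  assumes k: "3 \<le> k" and pm: "m + p = Suc k" and p: "2 \<le> p" and m: "even m" "0 < m"
begin

text \<open>The characteristic polynomial of the quotient of one block by its partition into
  \<open>p\<close> unmatched and \<open>m\<close> matched vertices.\<close>

abbreviation (input) quad :: "real \<Rightarrow> real" where
  "quad x \<equiv> x\<^sup>2 - (real k - 2) * x - (real k + real p - 1)"

text \<open>The larger root of \<open>quad\<close>: the discriminant
  \<open>(k - 2)\<^sup>2 + 4 * (k + p - 1)\<close> simplifies to
  \<open>k\<^sup>2 + 4 * p\<close>.\<close>

definition theta :: real where
  "theta = (real k - 2 + sqrt ((real k)\<^sup>2 + 4 * real p)) / 2"

lemma quad_factor:
  "quad x = (x - theta) * (x - (real k - 2 - sqrt ((real k)\<^sup>2 + 4 * real p)) / 2)"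
proof -
  define s where "s = sqrt ((real k)\<^sup>2 + 4 * real p)"
  have "s\<^sup>2 = (real k)\<^sup>2 + 4 * real p"
    unfolding s_def by simp
  then show ?thesis
    unfolding theta_def s_def[symmetric] by (simp add: power2_eq_square field_simps)
qed

lemma quad_theta: "quad theta = 0"
  unfolding quad_factor by simp

text \<open>The upper bound separates \<open>theta\<close> from the trivial eigenvalue
  \<open>k\<close>. The lower bound makes every \<open>l > theta\<close> exceed 2 and satisfy
  \<open>l\<^sup>2 > k\<close>, which justifies the divisions in the elimination below.\<close>

lemma theta_bounds: "real k - 1 < theta" "theta < real k"
proof -
  have "real k < sqrt ((real k)\<^sup>2 + 4 * real p)"
    using p by (intro real_less_rsqrt) simp
  then show "real k - 1 < theta"
    unfolding theta_def by simp
  have "real p \<le> real k" using pm m by linarith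
  then have "sqrt ((real k)\<^sup>2 + 4 * real p) < real k + 2"
    by (intro real_less_lsqrt) (auto simp: power2_eq_square algebra_simps)
  then show "theta < real k"
    unfolding theta_def by simp
qed

lemma quad_pos:
  assumes "theta < x"
  shows "0 < quad x"
proof -
  have "(real k - 2 - sqrt ((real k)\<^sup>2 + 4 * real p)) / 2 \<le> theta"
    unfolding theta_def by simp
  then show ?thesis
    unfolding quad_factor using assms by (intro mult_pos_pos) auto
qed

text \<open>Rows \<open>c < k\<close> of \<open>F\<close> are the values on the blocks and row
  \<open>k\<close> those on the cut vertices; the first two assumptions are then the eigenvalue
  equations at block and cut vertices.\<close>

lemma block_eigenfunction:
  fixes F :: "nat \<Rightarrow> nat \<Rightarrow> real"
  assumes block: "\<And>c i. c < k \<Longrightarrow> i < Suc k \<Longrightarrow>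
      (\<Sum>j<Suc k. F c j) - F c i + (if i < m then F k i - F c (partner i) else 0) = l * F c i"
    and cut: "\<And>i. i < m \<Longrightarrow> (\<Sum>c<k. F c i) = l * F k i"
    and l: "theta < l"
  obtains "\<And>c i. c < k \<Longrightarrow> i < Suc k \<Longrightarrow> F c i = 0" "\<And>i. i < m \<Longrightarrow> F k i = 0"
  | b where "l = real k" "\<And>c i. c < k \<Longrightarrow> i < Suc k \<Longrightarrow> F c i = b" "\<And>i. i < m \<Longrightarrow> F k i = b"
proof -
  define T where "T c = (\<Sum>j<Suc k. F c j)" for c
  have lk: "real k - 1 < l" using l theta_bounds by linarith
  then have l2: "2 < l" using k by linarith
  have "real k \<le> (real k - 1)\<^sup>2"
  proof -
    have "0 \<le> (real k - 3) * real k" using k by simp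
    then show ?thesis by (simp add: power2_eq_square algebra_simps)
  qed
  also have "\<dots> < l\<^sup>2"
    using lk k by (intro power_strict_mono) auto
  finally have lsq: "real k < l\<^sup>2" .
  have full: "(l + 1) * F c i = T c" if "c < k" "m \<le> i" "i < Suc k" for c i
    using block[of c i] that unfolding T_def by (simp add: algebra_simps)
  have m_le: "i < m \<Longrightarrow> i < Suc k" for i using pm by simp
  \<comment> \<open>The equations at \<open>i\<close> and at \<open>partner i\<close> both subtract
    \<open>F c i + F c (partner i)\<close> from the same block sum, so their difference retains only
    cut values on the right.\<close>
  have diff: "l * (F c i - F c (partner i)) = F k i - F k (partner i)"
    if c: "c < k" and i: "i < m" for c i
    using block[OF c m_le[OF i]] block[OF c m_le[OF partner_less[OF m(1) i]]]
      i partner_less[OF m(1) i] by (simp add: algebra_simps)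
  have matched: "F c i = F c (partner i)" if c: "c < k" and i: "i < m" for c i
  proof -
    \<comment> \<open>Differences across a pair form a closed system: summing \<open>diff\<close>
      over the blocks and using the cut equations gives \<open>l\<^sup>2 * ?s = k * ?s\<close>,
      which forces \<open>?s = 0\<close> since \<open>l\<^sup>2 > k\<close>.\<close>
    let ?s = "F k i - F k (partner i)"
    have "l * ?s = (\<Sum>d<k. F d i - F d (partner i))"
      using cut[OF i] cut[OF partner_less[OF m(1) i]]
      by (simp add: sum_subtractf right_diff_distrib)
    then have "l\<^sup>2 * ?s = (\<Sum>d<k. l * (F d i - F d (partner i)))"
      by (simp add: sum_distrib_left power2_eq_square mult.assoc)
    also have "\<dots> = real k * ?s"
      using diff i by simp
    finally have "?s = 0" using lsq by simp
    then show ?thesis using diff[OF c i] l2 by simp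
  qed
  have part: "(l + 2) * F c i = T c + F k i" if "c < k" "i < m" for c i
    using block[of c i] that m_le matched[OF that] unfolding T_def by (simp add: algebra_simps)
  define s where "s = F k 0"
  \<comment> \<open>Summing \<open>part\<close> over the blocks and inserting the cut equation
    yields a right-hand side independent of \<open>i\<close>, so all cut values agree.\<close>
  have cut_sum: "(l\<^sup>2 + 2 * l - real k) * F k i = (\<Sum>c<k. T c)" if "i < m" for i
  proof -
    have "(l + 2) * (l * F k i) = (\<Sum>c<k. (l + 2) * F c i)"
      unfolding cut[OF that, symmetric] by (rule sum_distrib_left)
    also have "\<dots> = (\<Sum>c<k. T c) + real k * F k i"
      using part that by (simp add: sum.distrib)
    finally show ?thesis by (simp add: power2_eq_square algebra_simps)
  qed
  have cut_const: "F k i = s" if "i < m" for i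
  proof -
    have "(l\<^sup>2 + 2 * l - real k) * F k i = (l\<^sup>2 + 2 * l - real k) * s"
      unfolding s_def using cut_sum that m by simp
    then show ?thesis using lsq l2 by simp
  qed
  \<comment> \<open>Index \<open>m\<close> is the first unmatched vertex and index 0 the first
    matched one; they represent the two parts of a block.\<close>
  define a b where "a c = F c m" and "b c = F c 0" for c
  have mk: "m < Suc k" using pm p by linarith
  have Fa: "F c i = a c" if "c < k" "m \<le> i" "i < Suc k" for c i
  proof -
    have "(l + 1) * F c i = (l + 1) * a c"
      unfolding a_def using full that mk by simp
    then show ?thesis using l2 by simp
  qed
  have Fb: "F c i = b c" if "c < k" "i < m" for c i
  proof -
    have "(l + 2) * F c i = (l + 2) * b c"
      unfolding b_def using part cut_const that m by simp
    then show ?thesis using l2 by simp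
  qed
  have T: "T c = real m * b c + real p * a c" if "c < k" for c
  proof -
    have "T c = (\<Sum>j<m. F c j) + (\<Sum>j=m..<Suc k. F c j)"
      unfolding T_def by (metis lessThan_atLeast0 less_imp_le mk sum.atLeastLessThan_concat zero_le)
    also have "\<dots> = (\<Sum>j<m. b c) + (\<Sum>j=m..<Suc k. a c)"
      using Fa Fb that by (intro arg_cong2[where f="(+)"] sum.cong) auto
    also have "\<dots> = real m * b c + real p * a c"
      using pm by simp
    finally show ?thesis .
  qed
  have eq_a: "(l + 1) * a c = T c" and eq_b: "(l + 2) * b c = T c + s" if "c < k" for c
    using full[of c m] part[of c 0] cut_const that mk m unfolding a_def b_def by auto
  have m_eq: "real m = real k + 1 - real p" using pm by linarith
  \<comment> \<open>Eliminating \<open>T c\<close> and \<open>a c\<close> leaves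
    \<open>quad l\<close> as the coefficient of \<open>b c\<close>. Since it is positive,
    \<open>b c\<close> is determined by \<open>s\<close> and hence does not depend on the
    block.\<close>
  have quad_b: "quad l * b c = (l + 1 - real p) * s" if "c < k" for c
  proof -
    have Tc: "T c = (l + 2) * b c - s" using eq_b[OF that] by simp
    have "(l + 1) * ((l + 2) * b c - s) =
        (l + 1) * real m * b c + real p * ((l + 1) * a c)"
      using T[OF that] unfolding Tc by (simp add: algebra_simps)
    also have "\<dots> = (l + 1) * real m * b c + real p * ((l + 2) * b c - s)"
      unfolding eq_a[OF that] Tc ..
    finally show ?thesis
      unfolding m_eq by (simp add: power2_eq_square algebra_simps)
  qed
  have qpos: "0 < quad l" using quad_pos[OF l] .
  define \<beta> where "\<beta> = b 0"
  have b_const: "b c = \<beta>" if "c < k" for c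
  proof -
    have "quad l * b c = quad l * \<beta>"
      unfolding \<beta>_def using quad_b that k by simp
    then show ?thesis using qpos by simp
  qed
  have ls: "l * s = real k * \<beta>"
  proof -
    have "l * s = (\<Sum>c<k. F c 0)" unfolding s_def using cut m by simp
    also have "\<dots> = real k * \<beta>" using b_const by (simp add: b_def)
    finally show ?thesis .
  qed
  have a: "(l + 1) * a c = (l + 2) * \<beta> - s" if "c < k" for c
    using eq_a[OF that] eq_b[OF that] b_const[OF that] by simp
  show thesis
  proof (cases "\<beta> = 0")
    case True
    then have "s = 0" using ls l2 by simp
    then have "a c = 0" if "c < k" for c
      using a[OF that] True l2 by simp
    then have "F c i = 0" if "c < k" "i < Suc k" for c i
      using Fa Fb b_const that True by (cases "i < m") auto
    moreover have "F k i = 0" if "i < m" for i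
      using cut_const that \<open>s = 0\<close> by simp
    ultimately show thesis by (rule that(1))
  next
    case False
    \<comment> \<open>Multiplying by \<open>l\<close> and substituting
      \<open>l * s = k * \<beta>\<close> gives a cubic in \<open>l\<close> divisible by
      \<open>l - k\<close>; the cofactor is positive because
      \<open>p \<le> k < l\<^sup>2\<close>.\<close>
    have "l * (quad l * \<beta>) = (l + 1 - real p) * (l * s)"
      using quad_b[of 0] k unfolding \<beta>_def by simp
    then have "\<beta> * ((l - real k) * (l\<^sup>2 + 2 * l - (real p - 1))) = 0"
      unfolding ls by (simp add: power2_eq_square algebra_simps)
    moreover have "real p \<le> real k" using pm m by linarith
    then have "l\<^sup>2 + 2 * l - (real p - 1) \<noteq> 0"
      using lsq l2 by simp
    ultimately have lk: "l = real k" using False by simp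
    then have s: "s = \<beta>" using ls k by simp
    have "a c = \<beta>" if "c < k" for c
    proof -
      have "(l + 1) * a c = (l + 1) * \<beta>"
        using a[OF that] unfolding s by (simp add: algebra_simps)
      then show ?thesis using l2 by simp
    qed
    then have "F c i = \<beta>" if "c < k" "i < Suc k" for c i
      using Fa Fb b_const that by (cases "i < m") auto
    moreover have "F k i = \<beta>" if "i < m" for i
      using cut_const that s by simp
    ultimately show thesis using lk by (intro that(2))
  qed
qed

section \<open>The graph and its vertex numbering\<close>

text \<open>The pair \<open>(c, i)\<close> with \<open>c < k\<close> is vertex \<open>i\<close> of the \<open>c\<close>-th block, where the matching removed from
  \<open>K\<^bsub>k+1\<^esub>\<close> consists of the pairs \<open>{2 l, 2 l + 1}\<close> below \<open>m\<close>; the pairs \<open>(k, i)\<close> with \<open>i < m\<close> are the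
  cut vertices.\<close>

definition adj :: "nat \<Rightarrow> nat \<Rightarrow> nat \<Rightarrow> nat \<Rightarrow> bool" where
  "adj c i d j \<longleftrightarrow>
    (if c = d then c < k \<and> i \<noteq> j \<and> \<not> (i < m \<and> j < m \<and> i div 2 = j div 2)
     else (c = k \<or> d = k) \<and> i = j \<and> i < m)"

text \<open>Row-by-row numbering with rows of length \<open>Suc k\<close>. The cut vertices form an
  incomplete last row of length \<open>m\<close>, so the valid pairs correspond exactly to the
  numbers below \<open>n\<close>.\<close>

definition vtx :: "nat \<Rightarrow> nat \<Rightarrow> nat" where
  "vtx c i = c * Suc k + i"

definition valid :: "nat \<Rightarrow> nat \<Rightarrow> bool" where
  "valid c i \<longleftrightarrow> c < k \<and> i < Suc k \<or> c = k \<and> i < m"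

definition n :: nat where
  "n = k * Suc k + m"

definition edge :: "nat \<Rightarrow> nat \<Rightarrow> bool" where
  "edge u v \<longleftrightarrow> adj (u div Suc k) (u mod Suc k) (v div Suc k) (v mod Suc k)"

definition G :: "nat pair_pre_digraph" where
  "G = \<lparr>pverts = {..<n}, parcs = {(u, v). u < n \<and> v < n \<and> edge u v}\<rparr>"

lemma m_less: "m < k"
  using pm p by linarith

lemma adj_sym: "adj c i d j \<longleftrightarrow> adj d j c i"
  by (auto simp: adj_def)

lemma edge_sym: "edge u v \<longleftrightarrow> edge v u"
  unfolding edge_def by (rule adj_sym)

lemma valid_index: "valid c i \<Longrightarrow> i < Suc k"
  using m_less by (auto simp: valid_def)

lemma vtx_div_mod [simp]:
  assumes "valid c i"
  shows "vtx c i div Suc k = c" "vtx c i mod Suc k = i"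
  using valid_index[OF assms] unfolding vtx_def by (simp_all del: mult_Suc_right)

lemma vtx_less:
  assumes "valid c i"
  shows "vtx c i < n"
proof (cases "c = k")
  case False
  then have c: "Suc c \<le> k" "i < Suc k" using assms by (auto simp: valid_def)
  have "vtx c i < Suc c * Suc k" using c unfolding vtx_def by simp
  also have "\<dots> \<le> k * Suc k" using c(1) by (rule mult_le_mono1)
  finally show ?thesis unfolding n_def by simp
qed (use assms in \<open>auto simp: valid_def vtx_def n_def\<close>)

lemma vtxE:
  assumes "v < n"
  obtains c i where "valid c i" "v = vtx c i"
proof
  show "v = vtx (v div Suc k) (v mod Suc k)"
    unfolding vtx_def by (metis div_mult_mod_eq)
  show "valid (v div Suc k) (v mod Suc k)"
  proof (cases "v < k * Suc k")
    case True
    then have "v div Suc k < k" by (simp add: less_mult_imp_div_less)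
    then show ?thesis unfolding valid_def by simp
  next
    case False
    then obtain i where i: "v = k * Suc k + i" by (metis le_Suc_ex not_less)
    then have "i < m" using assms unfolding n_def by simp
    then have "valid k i" "v = vtx k i" by (simp_all add: valid_def i vtx_def)
    then show ?thesis by simp
  qed
qed

lemma edge_vtx: "valid c i \<Longrightarrow> valid d j \<Longrightarrow> edge (vtx c i) (vtx d j) \<longleftrightarrow> adj c i d j"
  unfolding edge_def by simp

lemma sum_vertices:
  fixes g :: "nat \<Rightarrow> real"
  shows "(\<Sum>v<n. g v) = (\<Sum>c<k. \<Sum>i<Suc k. g (vtx c i)) + (\<Sum>i<m. g (vtx k i))"
proof -
  have shift: "(\<Sum>v=a..<a + b. g v) = (\<Sum>i<b. g (a + i))" for a b
    using sum.shift_bounds_nat_ivl[of g 0 a b] by (simp add: atLeast0LessThan add.commute)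
  have "(\<Sum>v<n. g v) = (\<Sum>v<k * Suc k. g v) + (\<Sum>v=k * Suc k..<n. g v)"
    unfolding n_def lessThan_atLeast0 by (rule sum.atLeastLessThan_concat[symmetric]) auto
  also have "(\<Sum>v<k * Suc k. g v) = (\<Sum>c<k. \<Sum>v=c * Suc k..<c * Suc k + Suc k. g v)"
    by (rule sum.nat_group[symmetric])
  also have "\<dots> = (\<Sum>c<k. \<Sum>i<Suc k. g (vtx c i))"
    unfolding shift vtx_def ..
  also have "(\<Sum>v=k * Suc k..<n. g v) = (\<Sum>i<m. g (vtx k i))"
    unfolding n_def shift vtx_def ..
  finally show ?thesis .
qed

section \<open>The adjacency operator and the second eigenvalue\<close>

definition entry :: "nat \<Rightarrow> nat \<Rightarrow> real" where
  "entry u v = (if edge u v then 1 else 0)"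

text \<open>Compared with a vertex of a complete block, a matched vertex exchanges its partner for
  its cut vertex, which also keeps its degree at \<open>k\<close>.\<close>

lemma row_sum_block:
  assumes c: "c < k" and i: "i < Suc k"
  shows "(\<Sum>v<n. entry (vtx c i) v * f v) =
    (\<Sum>j<Suc k. f (vtx c j)) - f (vtx c i) +
      (if i < m then f (vtx k i) - f (vtx c (partner i)) else 0)"
proof -
  have v: "valid c i" using c i by (simp add: valid_def)
  have e: "entry (vtx c i) (vtx d j) = (if adj c i d j then 1 else 0)" if "valid d j" for d j
    using edge_vtx[OF v that] by (simp add: entry_def)
  define S where "S = (\<Sum>j<Suc k. entry (vtx c i) (vtx c j) * f (vtx c j))"
  have "(\<Sum>j<Suc k. entry (vtx c i) (vtx d j) * f (vtx d j)) = (if d = c then S else 0)"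
    if "d < k" for d
    using that c unfolding S_def by (auto simp: valid_def e adj_def intro!: sum.neutral)
  then have "(\<Sum>d<k. \<Sum>j<Suc k. entry (vtx c i) (vtx d j) * f (vtx d j)) = S"
    using c by simp
  moreover have "S = (\<Sum>j<Suc k. f (vtx c j) - (if j = i then f (vtx c i) else 0) -
      (if j = partner i then (if i < m then f (vtx c (partner i)) else 0) else 0))"
    unfolding S_def
  proof (rule sum.cong)
    fix j assume "j \<in> {..<Suc k}"
    then have "entry (vtx c i) (vtx c j) = (if adj c i c j then 1 else 0)"
      using c by (intro e) (simp add: valid_def)
    moreover have "adj c i c j \<longleftrightarrow> j \<noteq> i \<and> \<not> (i < m \<and> j = partner i)"
      using c partner_less[OF m(1), of i] unfolding adj_def div_2_eq_iff_partner by auto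
    ultimately show "entry (vtx c i) (vtx c j) * f (vtx c j) = f (vtx c j) -
        (if j = i then f (vtx c i) else 0) -
        (if j = partner i then (if i < m then f (vtx c (partner i)) else 0) else 0)"
      by (auto simp: eq_commute[of _ "partner _"])
  qed simp
  moreover have "(\<Sum>j<m. entry (vtx c i) (vtx k j) * f (vtx k j)) =
      (\<Sum>j<m. if j = i then f (vtx k i) else 0)"
    using c by (intro sum.cong) (auto simp: e valid_def adj_def)
  moreover have "i < m \<Longrightarrow> partner i < Suc k"
    using partner_less[OF m(1)] m_less by fastforce
  ultimately show ?thesis
    unfolding sum_vertices using i by (simp add: sum_subtractf del: sum.lessThan_Suc)
qed

lemma row_sum_cut:
  assumes i: "i < m"
  shows "(\<Sum>v<n. entry (vtx k i) v * f v) = (\<Sum>c<k. f (vtx c i))"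
proof -
  have v: "valid k i" using i by (simp add: valid_def)
  have e: "entry (vtx k i) (vtx d j) = (if adj k i d j then 1 else 0)" if "valid d j" for d j
    using edge_vtx[OF v that] by (simp add: entry_def)
  have "(\<Sum>j<Suc k. entry (vtx k i) (vtx c j) * f (vtx c j)) =
      (\<Sum>j<Suc k. if j = i then f (vtx c i) else 0)" if "c < k" for c
    using that i by (intro sum.cong) (auto simp: e valid_def adj_def)
  then have "(\<Sum>j<Suc k. entry (vtx k i) (vtx c j) * f (vtx c j)) = f (vtx c i)" if "c < k" for c
    using that i m_less by (simp del: sum.lessThan_Suc)
  moreover have "(\<Sum>j<m. entry (vtx k i) (vtx k j) * f (vtx k j)) = 0"
    by (intro sum.neutral) (auto simp: e valid_def adj_def)
  ultimately show ?thesis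
    unfolding sum_vertices by simp
qed

lemma row_sum_1:
  assumes "u < n"
  shows "(\<Sum>v<n. entry u v) = real k"
  using assms
proof (rule vtxE)
  fix c i assume v: "valid c i" and u: "u = vtx c i"
  show ?thesis
  proof (cases "c = k")
    case True
    then show ?thesis using row_sum_cut[of i "\<lambda>_. 1"] v u by (simp add: valid_def)
  next
    case False
    then show ?thesis
      using row_sum_block[of c i "\<lambda>_. 1"] v u by (auto simp: valid_def)
  qed
qed

lemma entry_sym: "entry u v = entry v u"
  by (simp add: entry_def edge_sym)

lemma eigenfunction:
  assumes eig: "\<And>u. u < n \<Longrightarrow> (\<Sum>v<n. entry u v * f v) = l * f u" and l: "theta < l"
  obtains "\<And>u. u < n \<Longrightarrow> f u = 0" | "l = real k" "\<And>u. u < n \<Longrightarrow> f u = f 0"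
proof -
  have n0: "0 < n" using m by (simp add: n_def)
  show thesis
  proof (rule block_eigenfunction[of "\<lambda>c i. f (vtx c i)" l])
    fix c i assume "c < k" "i < Suc k"
    then show "(\<Sum>j<Suc k. f (vtx c j)) - f (vtx c i) +
        (if i < m then f (vtx k i) - f (vtx c (partner i)) else 0) = l * f (vtx c i)"
      using row_sum_block[of c i f] eig[of "vtx c i"] vtx_less[of c i]
      by (simp add: valid_def del: sum.lessThan_Suc)
  next
    fix i assume "i < m"
    then show "(\<Sum>c<k. f (vtx c i)) = l * f (vtx k i)"
      using row_sum_cut[of i f] eig[of "vtx k i"] vtx_less[of k i] by (simp add: valid_def)
  next
    show "theta < l" by (rule l)
  next
    assume "\<And>c i. c < k \<Longrightarrow> i < Suc k \<Longrightarrow> f (vtx c i) = 0" "\<And>i. i < m \<Longrightarrow> f (vtx k i) = 0"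
    then have "f u = 0" if "u < n" for u
      using vtxE[OF that] unfolding valid_def by metis
    then show thesis by (rule that(1))
  next
    fix b assume "l = real k"
      and "\<And>c i. c < k \<Longrightarrow> i < Suc k \<Longrightarrow> f (vtx c i) = b" "\<And>i. i < m \<Longrightarrow> f (vtx k i) = b"
    moreover from this(2,3) have "f u = b" if "u < n" for u
      using vtxE[OF that] unfolding valid_def by metis
    ultimately show thesis using n0 that(2) by metis
  qed
qed

lemma theta_eigenfunction:
  obtains f where "\<And>u. u < n \<Longrightarrow> (\<Sum>v<n. entry u v * f v) = theta * f u"
    "\<exists>u<n. f u \<noteq> 0"
proof -
  \<comment> \<open>The ratio of the two values of \<open>h\<close> solves the equation at an
    unmatched vertex, \<open>theta * y = (p - 1) * y + m * x\<close>; the equation at a matched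
    vertex then reduces to \<open>quad theta = 0\<close>.\<close>
  define h where "h i = (if i < m then theta - (real p - 1) else real m)" for i
  define s :: "nat \<Rightarrow> real" where "s c = (if c = 0 then 1 else if c = 1 then - 1 else 0)" for c
  define f where "f u = (let c = u div Suc k in if c = k then 0 else s c * h (u mod Suc k))" for u
  have f: "f (vtx c i) = s c * h i" if "c < k" "i < Suc k" for c i
    using that by (simp add: f_def valid_def)
  have f_cut: "f (vtx k i) = 0" if "i < m" for i
    using that by (simp add: f_def valid_def)
  have sum_h: "(\<Sum>j<Suc k. h j) = real m * (theta + 1)"
  proof -
    have "(\<Sum>j<Suc k. h j) = (\<Sum>j<m. h j) + (\<Sum>j=m..<Suc k. h j)"
      by (metis lessThan_atLeast0 less_imp_le less_SucI m_less sum.atLeastLessThan_concat zero_le)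
    also have "\<dots> = real m * (theta - (real p - 1)) + real p * real m"
      using pm by (simp add: h_def)
    finally show ?thesis by (simp add: algebra_simps)
  qed
  have m_eq: "real m = real k + 1 - real p" using pm by linarith
  have h_eq: "(\<Sum>j<Suc k. h j) - h i + (if i < m then - h (partner i) else 0) = theta * h i"
    if "i < Suc k" for i
  proof (cases "i < m")
    case True
    then have h: "h i = theta - (real p - 1)" "h (partner i) = theta - (real p - 1)"
      using partner_less[OF m(1)] by (auto simp: h_def)
    then show ?thesis
      unfolding sum_h m_eq h using True quad_theta by (simp add: power2_eq_square algebra_simps)
  next
    case False
    then show ?thesis
      unfolding sum_h by (simp add: h_def algebra_simps)
  qed
  have "(\<Sum>v<n. entry u v * f v) = theta * f u" if "u < n" for u
    using that
  proof (rule vtxE)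
    fix c i assume v: "valid c i" and u: "u = vtx c i"
    show ?thesis
    proof (cases "c = k")
      case True
      then have i: "i < m" using v by (simp add: valid_def)
      have "(\<Sum>c<k. s c) = (\<Sum>c\<in>{0, 1}. s c)"
        using k by (intro sum.mono_neutral_right) (auto simp: s_def)
      then have "(\<Sum>c<k. s c * h i) = 0"
        by (simp add: s_def flip: sum_distrib_right)
      then show ?thesis
        unfolding u True row_sum_cut[OF i] using f f_cut i m_less by simp
    next
      case False
      then have c: "c < k" and i: "i < Suc k" using v by (auto simp: valid_def)
      have "i < m \<Longrightarrow> partner i < Suc k"
        using partner_less[OF m(1)] m_less by fastforce
      then have "(\<Sum>v<n. entry u v * f v) =
          s c * ((\<Sum>j<Suc k. h j) - h i + (if i < m then - h (partner i) else 0))"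
        unfolding u row_sum_block[OF c i] using c i f f_cut
        by (simp add: right_diff_distrib distrib_left sum_distrib_left del: sum.lessThan_Suc)
      then show ?thesis
        unfolding h_eq[OF i] u using f[OF c i] by simp
    qed
  qed
  moreover have "f (vtx 0 m) \<noteq> 0" "vtx 0 m < n"
    using m_less m k f[of 0 m] vtx_less[of 0 m] by (auto simp: s_def h_def valid_def)
  ultimately show thesis using that by blast
qed

lemma adjacency_matrix_G: "adjacency_matrix (with_proj G) = mat n n (\<lambda>(u, v). entry u v)"
proof -
  have "sorted_list_of_set {..<n} = [0..<n]"
    by (simp add: lessThan_atLeast0)
  then show ?thesis
    by (intro eq_matI) (auto simp: adjacency_matrix_def Let_def G_def entry_def)
qed

lemma eigenvalue_iff:
  "eigenvalue (mat n n (\<lambda>(u, v). entry u v)) l \<longleftrightarrow>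
    (\<exists>f. (\<forall>u<n. (\<Sum>v<n. entry u v * f v) = l * f u) \<and> (\<exists>u<n. f u \<noteq> 0))" (is "?L \<longleftrightarrow> ?R")
proof
  assume ?L
  then obtain w where w: "w \<in> carrier_vec n" "w \<noteq> 0\<^sub>v n"
    "mat n n (\<lambda>(u, v). entry u v) *\<^sub>v w = l \<cdot>\<^sub>v w"
    unfolding eigenvalue_def eigenvector_def by auto
  have "(\<Sum>v<n. entry u v * w $ v) = l * w $ u" if "u < n" for u
    using arg_cong[OF w(3), of "\<lambda>x. x $ u"] w(1) that
    by (simp add: scalar_prod_def atLeast0LessThan)
  moreover have "\<exists>u<n. w $ u \<noteq> 0"
    using w(1,2) by (metis carrier_vecD eq_vecI index_zero_vec)
  ultimately show ?R by blast
next
  assume ?R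
  then obtain f u0 where f: "\<And>u. u < n \<Longrightarrow> (\<Sum>v<n. entry u v * f v) = l * f u"
    and u0: "u0 < n" "f u0 \<noteq> 0" by blast
  have "mat n n (\<lambda>(u, v). entry u v) *\<^sub>v vec n f = l \<cdot>\<^sub>v vec n f"
    using f by (intro eq_vecI) (auto simp: scalar_prod_def atLeast0LessThan)
  moreover have "vec n f \<noteq> 0\<^sub>v n"
    using u0 by (metis index_vec index_zero_vec(1))
  ultimately show ?L
    unfolding eigenvalue_def eigenvector_def by (intro exI[of _ "vec n f"]) auto
qed

lemma second_eigenvalue: "nth_eigenvalue (with_proj G) 2 = theta"
proof -
  let ?A = "mat n n (\<lambda>(u, v). entry u v)"
  have A: "?A \<in> carrier_mat n n" by simp
  have n0: "0 < n" using m by (simp add: n_def)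
  have root_iff: "poly (char_poly ?A) x = 0 \<longleftrightarrow> eigenvalue ?A x" for x
    using eigenvalue_root_char_poly[OF A] by simp
  have ord: "order (real k) (char_poly ?A) = 1"
  proof (rule order_char_poly_constant_row_sums[OF n0])
    fix v assume "v < n"
    then show "(\<Sum>u<n. entry u v) = real k"
      using row_sum_1[of v] by (subst entry_sym)
  next
    fix f i assume "\<And>u. u < n \<Longrightarrow> (\<Sum>v<n. entry u v * f v) = real k * f u" "i < n"
    then show "f i = f 0"
      using eigenfunction[of f "real k"] theta_bounds(2) n0 by metis
  qed (rule row_sum_1)
  have "rev (sorted_list_of_multiset (proots (char_poly ?A))) ! 1 = theta"
  proof (rule second_largest_root[OF _ ord _ theta_bounds(2)])
    show "char_poly ?A \<noteq> 0"
      using degree_monic_char_poly[OF A] by auto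
    show "poly (char_poly ?A) theta = 0"
      unfolding root_iff eigenvalue_iff using theta_eigenfunction by metis
  next
    fix x assume "poly (char_poly ?A) x = 0"
    then obtain f u where f: "\<And>u. u < n \<Longrightarrow> (\<Sum>v<n. entry u v * f v) = x * f u"
      and u: "u < n" "f u \<noteq> 0"
      unfolding root_iff eigenvalue_iff by blast
    show "x = real k \<or> x \<le> theta"
    proof (rule ccontr)
      assume "\<not> ?thesis"
      then have "theta < x" "x \<noteq> real k" by auto
      with f show False using u by (metis eigenfunction)
    qed
  qed
  then show ?thesis
    unfolding nth_eigenvalue_def adjacency_eigenvalues_def adjacency_matrix_G by simp
qed

end

section \<open>General tools for components, toughness and distance\<close>

text \<open>Vertices in a common strong component reach each other, so \<open>sep\<close> makes
  \<open>scc_of\<close> injective on \<open>A\<close>.\<close>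

lemma card_le_num_components:
  assumes "fin_digraph G" "A \<subseteq> verts G"
    and sep: "\<And>u v. u \<in> A \<Longrightarrow> v \<in> A \<Longrightarrow> u \<rightarrow>\<^sup>*\<^bsub>G\<^esub> v \<Longrightarrow> u = v"
  shows "card A \<le> num_components G"
proof -
  interpret fin_digraph G by fact
  have "inj_on scc_of A"
  proof (rule inj_onI)
    fix u v assume uv: "u \<in> A" "v \<in> A" "scc_of u = scc_of v"
    then have "v \<in> scc_of u" using in_scc_of_self[of v] assms(2) by auto
    then show "u = v" using sep[OF uv(1,2)] by (simp add: scc_of_def)
  qed
  then have "card A \<le> card sccs_verts"
    using assms(2) by (intro card_inj_on_le[of scc_of]) (auto intro: scc_of_in_sccs_verts finite_sccs_verts)
  then show ?thesis
    unfolding num_components_def card_sccs_verts .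
qed

lemma toughness_le:
  assumes "finite (verts G)" "S \<subseteq> verts G" "num_components (remove_verts G S) \<ge> 2"
  shows "toughness G \<le> real (card S) / real (num_components (remove_verts G S))"
  unfolding toughness_def
proof (rule Min_le)
  \<comment> \<open>\<open>Min\<close> is a lower bound only on a finite set; the ratios are the
    images of subsets of a finite vertex set.\<close>
  have "{real (card S) / real (num_components (remove_verts G S)) | S.
      S \<subseteq> verts G \<and> num_components (remove_verts G S) \<ge> 2} \<subseteq>
    (\<lambda>S. real (card S) / real (num_components (remove_verts G S))) ` Pow (verts G)"
    by auto
  then show "finite {real (card S) / real (num_components (remove_verts G S)) | S.
      S \<subseteq> verts G \<and> num_components (remove_verts G S) \<ge> 2}"
    using assms(1) by (meson finite_Pow_iff finite_imageI finite_subset)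
qed (use assms in blast)

context wf_digraph begin

text \<open>Reachability with a length budget. Budgets add under concatenation, so distance bounds
  compose without naming the walks.\<close>

definition near :: "nat \<Rightarrow> 'a \<Rightarrow> 'a \<Rightarrow> bool" where
  "near t u v \<longleftrightarrow> (\<exists>p. awalk u p v \<and> length p \<le> t)"

lemma near_refl: "u \<in> verts G \<Longrightarrow> near t u u"
  unfolding near_def by (intro exI[of _ "[]"]) (simp add: awalk_Nil_iff)

lemma near_adj: "u \<rightarrow>\<^bsub>G\<^esub> v \<Longrightarrow> near 1 u v"
  unfolding near_def using arc_implies_awalk by (fastforce simp: arcs_ends_conv)

lemma near_trans: "near s u v \<Longrightarrow> near t v w \<Longrightarrow> near (s + t) u w"
  unfolding near_def by (metis add_mono awalk_appendI length_append)

lemma near_mono: "near s u v \<Longrightarrow> s \<le> t \<Longrightarrow> near t u v"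
  unfolding near_def by (meson order_trans)

lemma awalk_cost_1: "awalk_cost (\<lambda>_. 1) p = length p"
  by (induction p) auto

lemma graph_dist_le: "near t u v \<Longrightarrow> graph_dist G u v \<le> ereal t"
  unfolding near_def graph_dist_def
  using min_cost_le_walk_cost[of u _ v "\<lambda>_. 1"]
  by (metis awalk_cost_1 ereal_less_eq(3) of_nat_mono order_trans)

text \<open>A potential that rises by at most 1 along each arc certifies a lower bound, since a walk
  has at least as many arcs as the total rise.\<close>

lemma graph_dist_ge:
  fixes h :: "'a \<Rightarrow> nat"
  assumes lip: "\<And>x y. x \<rightarrow>\<^bsub>G\<^esub> y \<Longrightarrow> h y \<le> h x + 1"
  shows "ereal (real (h v) - real (h u)) \<le> graph_dist G u v"
proof -
  have "real (h v) \<le> real (h u) + length p" if "awalk u p v" for p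
    using that
  proof (induction p arbitrary: u)
    case (Cons e p)
    then have "h (head G e) \<le> h (tail G e) + 1"
      by (intro lip) (auto simp: awalk_Cons_iff intro: in_arcs_imp_in_arcs_ends)
    then show ?case
      using Cons.IH[of "head G e"] Cons.prems by (auto simp: awalk_Cons_iff)
  qed (simp add: awalk_Nil_iff)
  then show ?thesis
    unfolding graph_dist_def \<mu>_def by (intro INF_greatest) (auto simp: awalk_cost_1 algebra_simps)
qed

end

context tough_graph begin

section \<open>Regularity, connectedness, diameter and toughness\<close>

lemma adj_irrefl: "\<not> adj c i c i"
  by (simp add: adj_def)

lemma pair_graph_G: "pair_graph G"
proof
  show "symmetric (with_proj G)"
    using edge_sym by (auto simp: G_def symmetric_def sym_def)
  show "finite (parcs G)"
    by (rule finite_subset[of _ "{..<n} \<times> {..<n}"]) (auto simp: G_def)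
  show "fst e \<noteq> snd e" if "e \<in> parcs G" for e
    using that adj_irrefl by (auto simp: G_def edge_def)
qed (auto simp: G_def)

interpretation G: pair_graph G
  by (rule pair_graph_G)

lemma regular_G: "regular_graph k (with_proj G)"
  unfolding regular_graph_def
proof
  fix u assume "u \<in> verts (with_proj G)"
  then have u: "u < n" by (simp add: G_def)
  have "out_arcs (with_proj G) u = Pair u ` {v. v < n \<and> edge u v}"
    using u by (auto simp: out_arcs_def G_def)
  then have "out_degree (with_proj G) u = card {v. v < n \<and> edge u v}"
    unfolding out_degree_def by (simp add: card_image inj_on_def)
  moreover have "real (card {v. v < n \<and> edge u v}) = (\<Sum>v<n. entry u v)"
    unfolding entry_def by (simp add: Int_def flip: sum.inter_filter)
  ultimately show "out_degree (with_proj G) u = k"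
    using row_sum_1[OF u] by simp
qed

lemma near_vtx:
  assumes "valid c i" "valid d j" "adj c i d j"
  shows "G.near 1 (vtx c i) (vtx d j)"
  using assms by (intro G.near_adj) (simp add: G_def vtx_less edge_vtx)

text \<open>The unmatched vertex \<open>m\<close> is adjacent to all the others in its block and
  serves as a hub.\<close>

lemma near_block:
  assumes c: "c < k" and i: "i < Suc k" and j: "j < Suc k"
  shows "G.near 2 (vtx c i) (vtx c j)"
proof -
  have hub: "G.near 1 (vtx c l) (vtx c m)" "G.near 1 (vtx c m) (vtx c l)"
    if l: "l < Suc k" for l
  proof -
    have v: "valid c l" "valid c m" using c l m_less by (auto simp: valid_def)
    have "G.near 1 (vtx c l) (vtx c m) \<and> G.near 1 (vtx c m) (vtx c l)"
    proof (cases "l = m")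
      case True
      then show ?thesis using v G.near_refl vtx_less by (simp add: G_def)
    next
      case False
      then have "adj c l c m" "adj c m c l" using c by (auto simp: adj_def)
      then show ?thesis using v near_vtx by blast
    qed
    then show "G.near 1 (vtx c l) (vtx c m)" "G.near 1 (vtx c m) (vtx c l)" by blast+
  qed
  show ?thesis
    using G.near_trans[OF hub(1)[OF i] hub(2)[OF j]] by (simp add: numeral_2_eq_2)
qed

lemma near_cut:
  assumes "c < k" "i < m"
  shows "G.near 1 (vtx c i) (vtx k i)" "G.near 1 (vtx k i) (vtx c i)"
proof -
  have "valid c i" "valid k i" "adj c i k i"
    using assms m_less by (auto simp: valid_def adj_def)
  then show "G.near 1 (vtx c i) (vtx k i)" "G.near 1 (vtx k i) (vtx c i)"
    using adj_sym near_vtx by blast+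
qed

lemma near_copies:
  assumes "c < k" "d < k" "i < m"
  shows "G.near 2 (vtx c i) (vtx d i)"
  using G.near_trans[OF near_cut(1)[OF assms(1,3)] near_cut(2)[OF assms(2,3)]]
  by (simp add: numeral_2_eq_2)

text \<open>A matched endpoint allows a change of block through its cut vertex, at cost 2 + 2. Two
  unmatched endpoints go through the matched vertices with index 0, at cost 1 + 2 + 1. A cut vertex
  first enters the block of the other endpoint, or block 0 if both are cut vertices.\<close>

lemma near_4:
  assumes "u < n" "v < n"
  shows "G.near 4 u v"
proof -
  obtain c i where u: "u = vtx c i" and ci: "valid c i" using vtxE[OF assms(1)] by metis
  obtain d j where v: "v = vtx d j" and dj: "valid d j" using vtxE[OF assms(2)] by metis
  have i: "i < Suc k" and j: "j < Suc k" using valid_index ci dj by auto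
  consider "c < k" "d < k" "i < m" | "c < k" "d < k" "j < m" | "c < k" "d < k" "m \<le> i" "m \<le> j"
    | "c = k" "i < m" "d < k" | "c < k" "d = k" "j < m" | "c = k" "d = k" "i < m" "j < m"
    using ci dj unfolding valid_def by linarith
  then show ?thesis
  proof cases
    case 1
    show ?thesis
      using G.near_trans[OF near_copies[OF 1] near_block[OF 1(2) i j]] unfolding u v by simp
  next
    case 2
    show ?thesis
      using G.near_trans[OF near_block[OF 2(1) i j] near_copies[OF 2]] unfolding u v by simp
  next
    case 3
    have "adj c i c 0" "adj d 0 d j" "valid c 0" "valid d 0"
      using 3 m by (auto simp: adj_def valid_def)
    then have "G.near 1 (vtx c i) (vtx c 0)" "G.near 1 (vtx d 0) (vtx d j)"
      using ci dj 3 near_vtx by blast+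
    then have "G.near (1 + 2 + 1) (vtx c i) (vtx d j)"
      using near_copies[OF 3(1,2) m(2)] by (blast intro: G.near_trans)
    then show ?thesis unfolding u v by (simp add: numeral_eq_Suc)
  next
    case 4
    show ?thesis
      using G.near_trans[OF near_cut(2)[OF 4(3,2)] near_block[OF 4(3) i j]] 4
      unfolding u v by (auto intro: G.near_mono)
  next
    case 5
    show ?thesis
      using G.near_trans[OF near_block[OF 5(1) i j] near_cut(1)[OF 5(1,3)]] 5
      unfolding u v by (auto intro: G.near_mono)
  next
    case 6
    have "0 < k" using k by simp
    then have "G.near (1 + 2 + 1) (vtx k i) (vtx k j)"
      using near_cut near_block[of 0 i j] 6 i j by (blast intro: G.near_trans)
    then show ?thesis unfolding u v 6 by (simp add: numeral_eq_Suc)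
  qed
qed

lemma connected_G: "Digraph_Component.connected (with_proj G)"
proof (rule wf_digraph.connectedI[OF G.wf_digraph_axioms])
  show "verts (with_proj G) \<noteq> {}"
    using m by (auto simp: G_def n_def)
next
  fix u v assume "u \<in> verts (with_proj G)" "v \<in> verts (with_proj G)"
  then have "G.near 4 u v" by (intro near_4) (auto simp: G_def)
  then have "u \<rightarrow>\<^sup>*\<^bsub>with_proj G\<^esub> v"
    unfolding G.near_def G.reachable_awalk by blast
  then show "u \<rightarrow>\<^sup>*\<^bsub>with_proj (mk_symmetric (with_proj G))\<^esub> v"
    by (rule G.reachable_mk_symmetricI)
qed

text \<open>The distance from the set of unmatched vertices of block 0, used as a potential for the
  lower bound on the diameter.\<close>

definition level :: "nat \<Rightarrow> nat \<Rightarrow> nat" where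
  "level c i =
    (if c = k then 2 else if c = 0 then (if i < m then 1 else 0) else if i < m then 3 else 4)"

lemma level_adj: "adj c i d j \<Longrightarrow> level d j \<le> level c i + 1"
  unfolding adj_def level_def by (auto split: if_splits)

lemma diameter_G: "graph_diameter (with_proj G) = 4"
proof (rule antisym)
  show "graph_diameter (with_proj G) \<le> 4"
    unfolding graph_diameter_def
  proof (intro SUP_least)
    fix u v assume "u \<in> verts (with_proj G)" "v \<in> verts (with_proj G)"
    then show "graph_dist (with_proj G) u v \<le> 4"
      using G.graph_dist_le[OF near_4, of u v] by (simp add: G_def)
  qed
  \<comment> \<open>Unmatched vertices of different blocks realize the diameter: here the levels are
    0 and 4.\<close>
  have "valid 0 m" "valid 1 m" using m_less k by (auto simp: valid_def)
  define h where "h v = level (v div Suc k) (v mod Suc k)" for v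
  have V: "vtx 0 m < n" "vtx 1 m < n"
    using \<open>valid 0 m\<close> \<open>valid 1 m\<close> by (auto intro: vtx_less)
  have "h (vtx 0 m) = 0" "h (vtx 1 m) = 4"
    using \<open>valid 0 m\<close> \<open>valid 1 m\<close> k by (auto simp: h_def level_def)
  moreover have "h y \<le> h x + 1" if "(x, y) \<in> parcs G" for x y
    using that level_adj unfolding h_def by (simp add: G_def edge_def)
  then have "ereal (real (h (vtx 1 m)) - real (h (vtx 0 m))) \<le>
      graph_dist (with_proj G) (vtx 0 m) (vtx 1 m)"
    by (rule G.graph_dist_ge)
  ultimately have "4 \<le> graph_dist (with_proj G) (vtx 0 m) (vtx 1 m)"
    by simp
  also have "\<dots> \<le> (SUP v\<in>verts (with_proj G). graph_dist (with_proj G) (vtx 0 m) v)"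
    using V by (intro SUP_upper) (simp add: G_def)
  also have "\<dots> \<le> graph_diameter (with_proj G)"
    unfolding graph_diameter_def using V by (intro SUP_upper) (simp add: G_def)
  finally show "4 \<le> graph_diameter (with_proj G)" .
qed

lemma toughness_G: "toughness (with_proj G) < 1"
proof -
  \<comment> \<open>\<open>S\<close> is the incomplete last row, that is, the cut vertices;
    \<open>A\<close> takes one matched vertex from each block.\<close>
  define S where "S = {k * Suc k..<n}"
  define A where "A = (\<lambda>c. vtx c 0) ` {..<k}"
  let ?H = "remove_verts (with_proj G) S"
  have S: "S \<subseteq> verts (with_proj G)" by (auto simp: S_def G_def)
  have low: "u < k * Suc k" if "u \<in> verts ?H" for u
    using that by (auto simp: S_def G_def remove_verts_def)
  have H: "fin_digraph ?H"
  proof -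
    interpret H: wf_digraph ?H
      unfolding remove_verts_def by (rule G.wellformed_induce_subgraph)
    show ?thesis
      by unfold_locales (auto simp: remove_verts_def G.pair_finite_verts G.pair_finite_arcs)
  qed
  interpret H: fin_digraph ?H by (rule H)
  have "card A \<le> num_components ?H"
  proof (rule card_le_num_components[OF H])
    have "vtx c 0 < k * Suc k" if "c < k" for c
      using that unfolding vtx_def by (metis add.right_neutral mult_less_cancel2 zero_less_Suc)
    then show "A \<subseteq> verts ?H"
      by (fastforce simp: A_def remove_verts_def S_def G_def n_def)
  next
    fix u v assume u: "u \<in> A" and v: "v \<in> A" and "u \<rightarrow>\<^sup>*\<^bsub>?H\<^esub> v"
    \<comment> \<open>The row number is constant along walks avoiding \<open>S\<close>, because an
      arc between different rows has an endpoint in row \<open>k\<close>.\<close>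
    from this(3) have "v div Suc k = u div Suc k"
    proof (induction rule: H.reachable_induct)
      case (step x y)
      then have "x \<in> verts ?H" "y \<in> verts ?H" "edge x y"
        by (auto simp: remove_verts_def G_def arcs_ends_conv)
      then have "x div Suc k < k" "y div Suc k < k" "edge x y"
        using low by (auto intro!: less_mult_imp_div_less)
      then have "x div Suc k = y div Suc k"
        unfolding edge_def adj_def by (auto split: if_splits)
      then show ?case using step by simp
    qed simp
    then show "u = v"
      using u v by (auto simp: A_def valid_def)
  qed
  moreover have "card A = k"
    unfolding A_def by (subst card_image) (auto simp: inj_on_def vtx_def simp del: mult_Suc_right)
  ultimately have comps: "k \<le> num_components ?H" by simp
  \<comment> \<open>As \<open>card S = m < k\<close>, the lower bound \<open>k\<close> on the number
    of components already brings the ratio below 1.\<close>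
  have "toughness (with_proj G) \<le> real (card S) / real (num_components ?H)"
    using k comps S by (intro toughness_le) (auto simp: G_def)
  also have "\<dots> < 1"
    using comps m_less by (simp add: S_def n_def)
  finally show ?thesis .
qed

end

theorem mainTheorem3:
  fixes k :: nat
  assumes "k \<ge> 3"
  shows "\<exists>G :: nat pair_pre_digraph.
    pair_graph G \<and> Digraph_Component.connected (with_proj G) \<and> regular_graph k (with_proj G) \<and>
    graph_diameter (with_proj G) = 4 \<and>
    toughness (with_proj G) < 1 \<and>
    nth_eigenvalue (with_proj G) 2 =
      (if odd k then (real k - 2 + sqrt ((real k)\<^sup>2 + 8)) / 2
       else (real k - 2 + sqrt ((real k)\<^sup>2 + 12)) / 2)"
proof -
  \<comment> \<open>The choice of \<open>p\<close> makes \<open>Suc k - p\<close> even, and positive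
    because an even \<open>k\<close> is at least 4; \<open>4 * p\<close> becomes 8 or 12.\<close>
  define p :: nat where "p = (if odd k then 2 else 3)"
  interpret tough_graph k p "Suc k - p"
    using assms by unfold_locales (auto simp: p_def)
  have "theta = (if odd k then (real k - 2 + sqrt ((real k)\<^sup>2 + 8)) / 2
       else (real k - 2 + sqrt ((real k)\<^sup>2 + 12)) / 2)"
    unfolding theta_def by (simp add: p_def)
  then show ?thesis
    using pair_graph_G connected_G regular_G diameter_G toughness_G second_eigenvalue
    by (intro exI[of _ G]) simp
qed

end
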